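(* Let $m,N\in\mathbb{N}$ and $(n_1,\dots,n_m)\in\mathbb{N}^m$ with $N=n_1n_2\cdots n_m$. Let $A_1,\dots,A_m\subset\mathbb{N}_0$ be an $m$-part sum system for $N$, i.e. $|A_j|=n_j$ and $\sum_{j=1}^m A_j=\langle N\rangle$. Let $C_j=A_j-\frac{1}{2}\max A_j$ for $j=1,\dots,m$. Define \[ \sigma_A(N)=\sum_{j=1}^m\frac{N}{n_j}\sum_{a\in A_j}a,\qquad \tau_C(N)=\sum_{j=1}^m\frac{N}{n_j}\sum_{c\in C_j}c^2 . \] Then \[ \sigma_A(N)=\frac{N(N-1)}{2}=\binom{N}{2},\qquad \tau_C(N)=\frac{N(N^2-1)}{12}=\frac12\binom{N+1}{3}. \]
   Context: $\langle N\rangle=\{0,1,\dots,N-1\}$. Sums of sets are Minkowski sums $X+Y=\{x+y:x\in X,y\in Y\}$, and $X-r=\{x-r:x\in X\}$. An $m$-part sum system for $N$ is a collection of sets $A_1,\dots,A_m\subset\mathbb{N}_0$ with $|A_j|=n_j$, $N=\prod_j n_j$, and $\sum_{j=1}^m A_j=\langle N\rangle$ (so each element of $\langle N\rangle$ is represented uniquely as $a_1+\dots+a_m$, $a_j\in A_j$). *)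

theory Defs
  imports Complex_Main "HOL-Library.Set_Algebras"
begin

text \<open>
  Addition of sets is the elementwise (Minkowski) addition of \<^theory>\<open>HOL-Library.Set_Algebras\<close>,
  so the big sum over \<open>A j\<close> below is an iterated Minkowski sum.
  Families are indexed by \<open>1, \<dots>, m\<close>; their values at other indices are irrelevant.
\<close>

definition sum_system :: "nat \<Rightarrow> nat \<Rightarrow> (nat \<Rightarrow> nat) \<Rightarrow> (nat \<Rightarrow> nat set) \<Rightarrow> bool" where
  "sum_system m N n A \<longleftrightarrow>
     (\<forall>j\<in>{1..m}. finite (A j) \<and> card (A j) = n j) \<and>
     N = (\<Prod>j=1..m. n j) \<and>
     (\<Sum>j=1..m. A j) = {0..<N}"

definition sigma_sum :: "nat \<Rightarrow> nat \<Rightarrow> (nat \<Rightarrow> nat) \<Rightarrow> (nat \<Rightarrow> nat set) \<Rightarrow> real" where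
  "sigma_sum m N n A = (\<Sum>j=1..m. real N / real (n j) * (\<Sum>a\<in>A j. real a))"

definition tau_sum :: "nat \<Rightarrow> nat \<Rightarrow> (nat \<Rightarrow> nat) \<Rightarrow> (nat \<Rightarrow> real set) \<Rightarrow> real" where
  "tau_sum m N n C = (\<Sum>j=1..m. real N / real (n j) * (\<Sum>c\<in>C j. c\<^sup>2))"

end

theory Submission
  imports Defs "HOL-Library.FuncSet" "HOL-Computational_Algebra.Fundamental_Theorem_Algebra"
begin

text \<open>
  Put \<open>P\<^sub>j(x) = \<Sum>a\<in>A\<^sub>j. x^a\<close>. The sum system property says
  \<open>P\<^sub>1 \<cdots> P\<^sub>m = 1 + x + \<dots> + x^(N-1)\<close>, so all roots of \<open>P\<^sub>j\<close> lie on the unit circle and differ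
  from 1. Since \<open>1 / (1 - z)\<close> has real part \<open>1/2\<close> for such \<open>z\<close>, the logarithmic derivative of \<open>P\<^sub>j\<close>
  at 1 equals half the degree: the mean of \<open>A\<^sub>j\<close> is \<open>Max A\<^sub>j / 2\<close>, i.e. \<open>C\<^sub>j\<close> has mean 0. Comparing
  degrees gives \<open>\<Sum>j. Max A\<^sub>j = N - 1\<close> and hence the first moment. In the second moment of
  \<open>x - (N-1)/2 = c\<^sub>1 + \<dots> + c\<^sub>m\<close> over \<open>x < N\<close> all mixed terms vanish.
\<close>

text \<open>The real part is \<open>(1 - Re z) / |1 - z|^2\<close>, and on the unit circle
  \<open>|1 - z|^2 = 2 * (1 - Re z)\<close>.\<close>

lemma Re_inverse_one_minus_unit:
  assumes "norm (z::complex) = 1" and "z \<noteq> 1"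
  shows "Re (1 / (1 - z)) = 1 / 2"
proof -
  have eq: "(Re z)\<^sup>2 + (Im z)\<^sup>2 = 1"
    using assms(1) by (simp add: cmod_def)
  have "Re z \<noteq> 1"
    using eq assms(2) by (auto simp: complex_eq_iff)
  moreover have "(1 - Re z)\<^sup>2 + (Im z)\<^sup>2 = 2 * (1 - Re z)"
    using eq by (simp add: power2_eq_square algebra_simps)
  ultimately show ?thesis
    by (simp add: Re_divide)
qed

text \<open>Splitting off a linear factor with root \<open>z\<close> adds \<open>1 / (1 - z)\<close>
  to the logarithmic derivative at 1, hence 1/2 to its real part. Induction on the degree takes care
  of multiplicities, and \<open>poly p 1 \<noteq> 0\<close> keeps the roots away from 1.\<close>

lemma Re_log_deriv_at_1:
  fixes p :: "complex poly"
  assumes "poly p 1 \<noteq> 0" and "\<And>z. poly p z = 0 \<Longrightarrow> norm z = 1"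
  shows "Re (poly (pderiv p) 1 / poly p 1) = real (degree p) / 2"
  using assms
proof (induction "degree p" arbitrary: p)
  case 0
  then have "pderiv p = 0"
    by (simp add: pderiv_eq_0_iff)
  with 0 show ?case by simp
next
  case (Suc d)
  have "\<not> constant (poly p)"
    using Suc.hyps(2) by (simp add: constant_degree)
  then obtain z where z: "poly p z = 0"
    using fundamental_theorem_of_algebra by blast
  then obtain q where q: "p = [:-z, 1:] * q"
    by (metis dvdE poly_eq_0_iff_dvd)
  have z1: "norm z = 1" "z \<noteq> 1" and q1: "poly q 1 \<noteq> 0"
    using Suc.prems z q by auto
  have "q \<noteq> 0"
    using q1 by auto
  then have deg: "degree p = Suc (degree q)"
    unfolding q by (subst degree_mult_eq) auto
  have "Re (poly (pderiv q) 1 / poly q 1) = real (degree q) / 2"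
    using Suc.hyps(1)[of q] Suc.hyps(2) deg q1 Suc.prems(2) q by simp
  moreover have "poly (pderiv p) 1 / poly p 1 = 1 / (1 - z) + poly (pderiv q) 1 / poly q 1"
  proof -
    have "pderiv p = [:-z, 1:] * pderiv q + q"
      unfolding q pderiv_mult by (simp add: pderiv_pCons)
    then have "poly (pderiv p) 1 = (1 - z) * poly (pderiv q) 1 + poly q 1"
      by (simp add: left_diff_distrib)
    moreover have "poly p 1 = (1 - z) * poly q 1"
      unfolding q by (simp add: algebra_simps)
    ultimately show ?thesis
      using z1 q1 by (simp add: add_divide_distrib)
  qed
  ultimately show ?case
    using Re_inverse_one_minus_unit[OF z1] deg by (simp add: add_divide_distrib)
qed

text \<open>The generating polynomial of \<open>S\<close>, with complex coefficients so that the
  fundamental theorem of algebra provides its roots.\<close>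

definition set_poly :: "nat set \<Rightarrow> complex poly" where
  "set_poly S = (\<Sum>a\<in>S. monom 1 a)"

lemma poly_set_poly: "poly (set_poly S) z = (\<Sum>a\<in>S. z ^ a)"
  by (simp add: set_poly_def poly_sum poly_monom)

lemma degree_set_poly:
  assumes "finite S" and "S \<noteq> {}"
  shows "degree (set_poly S) = Max S"
proof (rule antisym)
  show "degree (set_poly S) \<le> Max S"
    unfolding set_poly_def
    by (rule degree_sum_le) (auto simp: assms degree_monom_eq)
  have "coeff (set_poly S) (Max S) = 1"
    using assms by (simp add: set_poly_def coeff_sum coeff_monom)
  then show "Max S \<le> degree (set_poly S)"
    by (intro le_degree) simp
qed

text \<open>At 1 the generating polynomial has value \<open>card S\<close> and its derivative has
  value \<open>\<Sum>S\<close>, so the logarithmic derivative there is the mean of \<open>S\<close>.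
  It is real, so passing to real parts loses nothing.\<close>

lemma sum_eq_half_Max:
  assumes "finite S" and "S \<noteq> {}"
    and "\<And>z::complex. (\<Sum>a\<in>S. z ^ a) = 0 \<Longrightarrow> norm z = 1"
  shows "(\<Sum>a\<in>S. real a) = real (card S) * (real (Max S) / 2)"
proof -
  have "poly (set_poly S) 1 = of_nat (card S)"
    by (simp add: poly_set_poly)
  moreover have "poly (pderiv (set_poly S)) 1 = of_nat (\<Sum>S)"
    \<comment> \<open>The instance of order 1 is termwise differentiation.\<close>
    using higher_pderiv_sum[of 1 "monom (1::complex)" S]
    by (simp add: set_poly_def pderiv_monom poly_sum poly_monom del: of_nat_sum)
      (simp add: poly_sum poly_monom)
  moreover have "card S \<noteq> 0"
    using assms by auto
  ultimately have "Re (of_nat (\<Sum>S) / of_nat (card S)) = real (Max S) / 2"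
    using Re_log_deriv_at_1[of "set_poly S"] assms by (simp add: poly_set_poly degree_set_poly)
  moreover have "Re (of_nat (\<Sum>S) / of_nat (card S)) = real (\<Sum>S) / real (card S)"
    by (metis Re_complex_of_real of_real_divide of_real_of_nat_eq)
  ultimately show ?thesis
    using \<open>card S \<noteq> 0\<close> by (simp add: field_simps)
qed

text \<open>Uniqueness of representations comes from counting: a surjection between finite sets of
  equal size is injective.\<close>

lemma bij_betw_direct_set_sum:
  fixes A :: "'i \<Rightarrow> 'a::comm_monoid_add set"
  assumes "finite I" and "\<And>i. i \<in> I \<Longrightarrow> finite (A i)"
    and "card (\<Sum>i\<in>I. A i) = (\<Prod>i\<in>I. card (A i))"
  shows "bij_betw (\<lambda>g. \<Sum>i\<in>I. g i) (PiE I A) (\<Sum>i\<in>I. A i)"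
proof -
  have "(\<lambda>g. \<Sum>i\<in>I. g i) ` PiE I A = (\<Sum>i\<in>I. A i)"
  proof
    show "(\<lambda>g. \<Sum>i\<in>I. g i) ` PiE I A \<subseteq> (\<Sum>i\<in>I. A i)"
      by (auto simp: set_sum_alt[OF assms(1)])
    show "(\<Sum>i\<in>I. A i) \<subseteq> (\<lambda>g. \<Sum>i\<in>I. g i) ` PiE I A"
    proof
      fix x assume "x \<in> (\<Sum>i\<in>I. A i)"
      then obtain s where "x = sum s I" "\<forall>i\<in>I. s i \<in> A i"
        by (auto simp: set_sum_alt[OF assms(1)])
      then show "x \<in> (\<lambda>g. \<Sum>i\<in>I. g i) ` PiE I A"
        \<comment> \<open>Members of \<open>PiE I A\<close> are \<open>undefined\<close> outside
          \<open>I\<close>, so the chosen summands must be restricted.\<close>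
        by (intro image_eqI[of _ _ "restrict s I"]) auto
    qed
  qed
  moreover from this have "inj_on (\<lambda>g. \<Sum>i\<in>I. g i) (PiE I A)"
    using assms by (intro eq_card_imp_inj_on) (auto simp: finite_PiE card_PiE)
  ultimately show ?thesis
    by (simp add: bij_betw_def)
qed

text \<open>Expanding the product gives one monomial per choice function \<open>g\<close>, and the
  bijection makes each exponent in \<open>S\<close> occur exactly once.\<close>

lemma prod_set_poly:
  assumes "finite I" and "\<And>i. i \<in> I \<Longrightarrow> finite (A i)"
    and "bij_betw (\<lambda>g. \<Sum>i\<in>I. g i) (PiE I A) S"
  shows "(\<Prod>i\<in>I. set_poly (A i)) = set_poly S"
proof -
  have monom: "(\<Prod>i\<in>I. monom 1 (g i)) = monom (1::complex) (\<Sum>i\<in>I. g i)" for g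
    using assms(1) by (induction rule: finite_induct) (auto simp: mult_monom)
  have "(\<Prod>i\<in>I. set_poly (A i)) = (\<Sum>g\<in>PiE I A. \<Prod>i\<in>I. monom 1 (g i))"
    unfolding set_poly_def using assms by (intro prod_sum_PiE) auto
  also have "\<dots> = set_poly S"
    unfolding set_poly_def monom by (rule sum.reindex_bij_betw[OF assms(3)])
  finally show ?thesis .
qed

lemma sum_PiE_insert:
  assumes "j \<notin> I"
  shows "(\<Sum>g\<in>PiE (insert j I) A. F g) = (\<Sum>a\<in>A j. \<Sum>g\<in>PiE I A. F (g(j := a)))"
proof -
  have "(\<Sum>g\<in>PiE (insert j I) A. F g) = (\<Sum>(a, g)\<in>A j \<times> PiE I A. F (g(j := a)))"
    unfolding PiE_insert_eq
    by (subst sum.reindex[OF inj_combinator[OF assms]]) (simp add: case_prod_unfold)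
  then show ?thesis
    by (simp add: sum.cartesian_product)
qed

text \<open>Additivity of variance for independent centred variables, multiplied by the number of
  choice functions. The weight of \<open>i\<close> counts the choice functions with a prescribed
  value at \<open>i\<close>.\<close>

lemma sum_PiE_square_centred:
  fixes h :: "'i \<Rightarrow> 'a \<Rightarrow> real"
  assumes "finite I" and "\<And>i. i \<in> I \<Longrightarrow> finite (A i)" and "\<And>i. i \<in> I \<Longrightarrow> A i \<noteq> {}"
    and "\<And>i. i \<in> I \<Longrightarrow> (\<Sum>a\<in>A i. h i a) = 0"
  shows "(\<Sum>g\<in>PiE I A. (\<Sum>i\<in>I. h i (g i))\<^sup>2) =
    (\<Sum>i\<in>I. (\<Prod>k\<in>I. real (card (A k))) / real (card (A i)) * (\<Sum>a\<in>A i. (h i a)\<^sup>2))"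
  using assms
proof (induction rule: finite_induct)
  case empty
  then show ?case by simp
next
  case (insert j I)
  define H where "H g = (\<Sum>i\<in>I. h i (g i))" for g
  define M where "M = (\<Prod>k\<in>I. real (card (A k)))"
  have card_PiE: "real (card (PiE I A)) = M"
    using insert.hyps by (simp add: card_PiE M_def)
  have cj: "real (card (A j)) \<noteq> 0"
    using insert.prems by simp
  have upd: "(\<Sum>i\<in>insert j I. h i ((g(j := a)) i)) = h j a + H g" for g a
  proof -
    have "(\<Sum>i\<in>I. h i ((g(j := a)) i)) = H g"
      unfolding H_def using insert.hyps by (intro sum.cong) auto
    then show ?thesis
      using insert.hyps by simp
  qed
  have "(\<Sum>g\<in>PiE (insert j I) A. (\<Sum>i\<in>insert j I. h i (g i))\<^sup>2)
      = (\<Sum>a\<in>A j. \<Sum>g\<in>PiE I A. (h j a + H g)\<^sup>2)"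
    unfolding sum_PiE_insert[OF insert.hyps(2)] upd ..
  also have "\<dots> = (\<Sum>a\<in>A j. M * (h j a)\<^sup>2 + 2 * (\<Sum>g\<in>PiE I A. H g) * h j a + (\<Sum>g\<in>PiE I A. (H g)\<^sup>2))"
    by (simp add: power2_sum sum.distrib card_PiE sum_distrib_left sum_distrib_right algebra_simps)
  \<comment> \<open>The coefficient of \<open>h j a\<close> in the mixed term does not depend on
    \<open>a\<close>, so centring at \<open>j\<close> alone removes that term.\<close>
  also have "\<dots> = M * (\<Sum>a\<in>A j. (h j a)\<^sup>2) + real (card (A j)) * (\<Sum>g\<in>PiE I A. (H g)\<^sup>2)"
    using insert.prems(3)[of j] by (simp add: sum.distrib flip: sum_distrib_left)
  also have "(\<Sum>g\<in>PiE I A. (H g)\<^sup>2) = (\<Sum>i\<in>I. M / real (card (A i)) * (\<Sum>a\<in>A i. (h i a)\<^sup>2))"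
    unfolding H_def M_def using insert.prems by (intro insert.IH) auto
  also have "real (card (A j)) * \<dots> =
      (\<Sum>i\<in>I. real (card (A j)) * M / real (card (A i)) * (\<Sum>a\<in>A i. (h i a)\<^sup>2))"
    by (simp add: sum_distrib_left[of _ _ I] mult.assoc)
  finally show ?case
    using insert.hyps cj by (simp flip: M_def)
qed

lemma sum_square_centred_lessThan:
  "(\<Sum>k<N. (real k - (real N - 1) / 2)\<^sup>2) = real N * ((real N)\<^sup>2 - 1) / 12"
proof -
  \<comment> \<open>The centre varies with \<open>N\<close>, so the induction is done for a fixed
    \<open>c\<close> that is specialised afterwards.\<close>
  have "(\<Sum>k<N. (real k - c)\<^sup>2)
      = real N * (real N - 1) * (2 * real N - 1) / 6 - c * real N * (real N - 1) + real N * c\<^sup>2" for c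
    by (induction N) (simp_all add: field_simps power2_eq_square)
  from this[of "(real N - 1) / 2"] show ?thesis
    by (simp only:) (simp add: field_simps power2_eq_square)
qed

lemma of_nat_choose_2: "real (N choose 2) = real N * (real N - 1) / 2"
  by (induction N) (simp_all add: numeral_2_eq_2 field_simps)

lemma of_nat_Suc_choose_3: "real ((N + 1) choose 3) = real N * ((real N)\<^sup>2 - 1) / 6"
proof (induction N)
  case (Suc N)
  have "real ((Suc N + 1) choose 3) = real (Suc N choose 2) + real ((N + 1) choose 3)"
    by (simp add: eval_nat_numeral)
  then show ?case
    unfolding Suc of_nat_choose_2 by (simp add: field_simps power2_eq_square)
qed simp

theorem theorem2p1:
  fixes m N :: nat and n :: "nat \<Rightarrow> nat"
    and A :: "nat \<Rightarrow> nat set" and C :: "nat \<Rightarrow> real set"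
  assumes "m \<ge> 1" and "N \<ge> 1"
    and "\<forall>j\<in>{1..m}. n j \<ge> 1"
    and "N = (\<Prod>j=1..m. n j)"
    and "sum_system m N n A"
    and "\<forall>j\<in>{1..m}. C j = {real a - 1 / 2 * real (Max (A j)) | a. a \<in> A j}"
  shows "sigma_sum m N n A = real N * (real N - 1) / 2
    \<and> real N * (real N - 1) / 2 = real (N choose 2)
    \<and> tau_sum m N n C = real N * ((real N)\<^sup>2 - 1) / 12
    \<and> real N * ((real N)\<^sup>2 - 1) / 12 = 1 / 2 * real ((N + 1) choose 3)"
proof -
  let ?I = "{1..m}"
  have fin: "finite (A j)" and card: "card (A j) = n j" if "j \<in> ?I" for j
    using assms(5) that by (auto simp: sum_system_def)
  have set_sum: "(\<Sum>j\<in>?I. A j) = {..<N}"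
    using assms(5) by (auto simp: sum_system_def)
  have npos: "real (n j) > 0" and ne: "A j \<noteq> {}" if "j \<in> ?I" for j
    using assms(3) card[OF that] that by force+
  have bij: "bij_betw (\<lambda>g. \<Sum>j\<in>?I. g j) (PiE ?I A) {..<N}"
    using bij_betw_direct_set_sum[of ?I A] fin card set_sum assms(4) by simp
  have prod: "(\<Prod>j\<in>?I. set_poly (A j)) = set_poly {..<N}"
    using fin bij by (intro prod_set_poly) auto
  have N0: "{..<N} \<noteq> {}"
    using assms(2) by (simp add: lessThan_empty_iff)

  have unit: "norm z = 1" if j: "j \<in> ?I" and z: "(\<Sum>a\<in>A j. z ^ a) = 0" for j and z :: complex
  proof -
    have "poly (set_poly {..<N}) z = 0"
      using j z by (auto simp: poly_prod poly_set_poly simp flip: prod)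
    \<comment> \<open>Multiply the vanishing geometric sum by \<open>z - 1\<close>.\<close>
    then have "z ^ N = 1"
      using power_diff_1_eq[of z N] by (simp add: poly_set_poly)
    then have "norm z ^ N = 1"
      by (simp flip: norm_power)
    then show ?thesis
      using assms(2) power_eq_imp_eq_base[of "norm z" N 1] by simp
  qed
  have mean: "(\<Sum>a\<in>A j. real a) = real (n j) * (real (Max (A j)) / 2)" if "j \<in> ?I" for j
    using sum_eq_half_Max[OF fin[OF that] ne[OF that] unit[OF that]] card[OF that] by simp

  \<comment> \<open>Degrees add only over nonzero factors; here the value at 1 is a positive
    cardinality.\<close>
  have "set_poly (A j) \<noteq> 0" if "j \<in> ?I" for j
    using npos[OF that] card[OF that] poly_set_poly[of "A j" 1] by auto
  then have "(\<Sum>j\<in>?I. degree (set_poly (A j))) = degree (set_poly {..<N})"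
    unfolding prod[symmetric] by (intro degree_prod_eq_sum_degree[symmetric]) auto
  then have "(\<Sum>j\<in>?I. Max (A j)) = Max {..<N}"
    using fin ne N0 by (simp add: degree_set_poly)
  also have "Max {..<N} = N - 1"
    using assms(2) by (intro Max_eqI) auto
  finally have Max_sum: "(\<Sum>j\<in>?I. real (Max (A j))) = real N - 1"
    using assms(2) by (simp add: of_nat_diff flip: of_nat_sum)

  have "sigma_sum m N n A = (\<Sum>j\<in>?I. real N / 2 * real (Max (A j)))"
    unfolding sigma_sum_def
  proof (rule sum.cong)
    show "real N / real (n j) * (\<Sum>a\<in>A j. real a) = real N / 2 * real (Max (A j))"
      if "j \<in> ?I" for j
      unfolding mean[OF that] using npos[OF that] by simp
  qed simp
  also have "\<dots> = real N * (real N - 1) / 2"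
    unfolding sum_distrib_left[symmetric] Max_sum by simp
  finally have sigma: "sigma_sum m N n A = real N * (real N - 1) / 2" .

  define h where "h j a = real a - real (Max (A j)) / 2" for j a
  \<comment> \<open>By \<open>Max_sum\<close> the individual centres add up to the centre of
    \<open>{..<N}\<close>.\<close>
  have sum_h: "(\<Sum>j\<in>?I. h j (g j)) = real (\<Sum>j\<in>?I. g j) - (real N - 1) / 2" for g
    by (simp add: h_def sum_subtractf Max_sum[simplified] flip: sum_divide_distrib)
  have C: "(\<Sum>c\<in>C j. c\<^sup>2) = (\<Sum>a\<in>A j. (h j a)\<^sup>2)" if "j \<in> ?I" for j
  proof -
    have "C j = h j ` A j"
      using assms(6) that by (auto simp: h_def)
    \<comment> \<open>\<open>C j\<close> is a set, so injectivity ensures that no square is lost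
      when the sum is pulled back to \<open>A j\<close>.\<close>
    moreover have "inj_on (h j) (A j)"
      by (auto simp: inj_on_def h_def)
    ultimately show ?thesis
      by (simp add: sum.reindex)
  qed
  have "tau_sum m N n C
      = (\<Sum>j\<in>?I. (\<Prod>k\<in>?I. real (card (A k))) / real (card (A j)) * (\<Sum>a\<in>A j. (h j a)\<^sup>2))"
    unfolding tau_sum_def using card by (intro sum.cong) (auto simp: C assms(4))
  also have "\<dots> = (\<Sum>g\<in>PiE ?I A. (\<Sum>j\<in>?I. h j (g j))\<^sup>2)"
    using fin ne by (intro sum_PiE_square_centred[symmetric])
      (auto simp: h_def sum_subtractf mean card)
  \<comment> \<open>The summand depends on \<open>g\<close> only through its total, which runs once
    through \<open>{..<N}\<close>.\<close>
  also have "\<dots> = (\<Sum>k<N. (real k - (real N - 1) / 2)\<^sup>2)"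
    unfolding sum_h by (rule sum.reindex_bij_betw[OF bij])
  also have "\<dots> = real N * ((real N)\<^sup>2 - 1) / 12"
    by (rule sum_square_centred_lessThan)
  finally have tau: "tau_sum m N n C = real N * ((real N)\<^sup>2 - 1) / 12" .

  show ?thesis
    unfolding of_nat_choose_2 of_nat_Suc_choose_3 using sigma tau by simp
qed

end
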